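(* Assume $\kappa^->\kappa^+$ and let $\rho^-,\rho^+$ satisfy $0<\rho^-<\hat\rho<\rho^+<1$ and $f(\kappa^-,\rho^-)=f(\kappa^+,\rho^+)=:\bar f$. Then there exist infinitely many monotone functions $Q:\mathbb{R}\setminus\{0\}\to[0,1]$ (stationary profiles) satisfying $$Q(x)\,\kappa(x)\,v(A(Q;x))=\bar f\qquad\text{for all } x\neq 0,$$ and the boundary conditions $$\lim_{x\to-\infty}Q(x)=\rho^-,\qquad \lim_{x\to+\infty}Q(x)=\rho^+ .$$ These profiles are discontinuous at $x=0$ (that is, $Q(0-)\ne Q(0+)$), but are continuous on $x>0$ and on $x<0$.
   Context: Fix $h>0$ and $\kappa^-,\kappa^+>0$, and let $\kappa(x)=\kappa^-$ for $x<0$ and $\kappa(x)=\kappa^+$ for $x>0$. The function $v\in C^2$ satisfies $v(0)=1$, $v(1)=0$, $v'(\rho)<0$ and $v''(\rho)\le 0$ for all $\rho\in[0,1]$. The weight $w\ge 0$ is defined on $x\ge0$, is continuous and bounded on $x>0$, and satisfies $\int_0^h w(x)\,dx=1$, $w(x)=0$ for all $x\ge h$, and $w'(x)<0$ for all $x\in(0,h)$. Put $A(Q;x)=\int_x^{x+h}Q(y)w(y-x)\,dy=\int_0^hQ(x+s)w(s)\,ds$ and $f(\kappa,\rho)=\kappa\,\rho\,v(\rho)$. The number $\hat\rho\in(0,1)$ is the unique point (independent of $\kappa>0$) with $f_\rho(\kappa,\hat\rho)=0$, $f_\rho(\kappa,\rho)>0$ for $\rho<\hat\rho$ and $f_\rho(\kappa,\rho)<0$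 for $\rho>\hat\rho$. A stationary profile $Q$ is a stationary solution of the nonlocal conservation law $\rho_t+[\rho(t,x)\kappa(x)v(\int_x^{x+h}\rho(t,y)w(y-x)\,dy)]_x=0$; since $A(Q;\cdot)$ is continuous, its traces at $0$ satisfy the connecting condition $\kappa^-Q(0-)=\kappa^+Q(0+)$. *)

theory Defs
  imports "HOL-Analysis.Analysis"
begin

(* The value at x = 0 is never used. *)
definition kappa :: "real \<Rightarrow> real \<Rightarrow> real \<Rightarrow> real" where
  "kappa km kp x = (if x < 0 then km else kp)"

definition flux :: "(real \<Rightarrow> real) \<Rightarrow> real \<Rightarrow> real \<Rightarrow> real" where
  "flux v k r = k * r * v r"

definition avg :: "real \<Rightarrow> (real \<Rightarrow> real) \<Rightarrow> (real \<Rightarrow> real) \<Rightarrow> real \<Rightarrow> real" where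
  "avg h w Q x = integral {x..x + h} (\<lambda>y. Q y * w (y - x))"

(* Weak form of [Q(x) kappa(x) v(A(Q;x))]_x = 0, tested against continuously
   differentiable functions p of compact support; for rho(t,x) = Q(x) the time-derivative
   term of the weak formulation of the conservation law vanishes. *)
definition stationary_solution ::
    "real \<Rightarrow> real \<Rightarrow> real \<Rightarrow> (real \<Rightarrow> real) \<Rightarrow> (real \<Rightarrow> real) \<Rightarrow> (real \<Rightarrow> real) \<Rightarrow> bool" where
  "stationary_solution km kp h v w Q \<longleftrightarrow>
     (\<forall>p p'. (\<forall>x. (p has_real_derivative p' x) (at x)) \<and> continuous_on UNIV p' \<and>
             (\<exists>R. \<forall>x. \<bar>x\<bar> > R \<longrightarrow> p x = 0) \<longrightarrow>
        ((\<lambda>x. Q x * kappa km kp x * v (avg h w Q x) * p' x) has_integral 0) UNIV)"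

(* Q is a function on R - {0}: extensionality fixes the irrelevant value Q 0, so that
   functions differing only at 0 are not counted as distinct profiles. *)
definition monotone_profiles ::
    "real \<Rightarrow> real \<Rightarrow> real \<Rightarrow> (real \<Rightarrow> real) \<Rightarrow> (real \<Rightarrow> real) \<Rightarrow> real \<Rightarrow> real \<Rightarrow> real
       \<Rightarrow> (real \<Rightarrow> real) set" where
  "monotone_profiles km kp h v w fbar rm rp =
     {Q \<in> (UNIV - {0}) \<rightarrow>\<^sub>E {0..1}.
        (monotone_on (UNIV - {0}) (\<le>) (\<le>) Q \<or> monotone_on (UNIV - {0}) (\<le>) (\<ge>) Q) \<and>
        stationary_solution km kp h v w Q \<and>
        (\<forall>x. x \<noteq> 0 \<longrightarrow> Q x * kappa km kp x * v (avg h w Q x) = fbar) \<and>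
        (Q \<longlongrightarrow> rm) at_bot \<and> (Q \<longlongrightarrow> rp) at_top}"

end

theory Submission
  imports Defs
begin

text \<open>
  On each side of the interface the equation \<open>Q x * kappa x * v (A x) = fbar\<close>, where \<open>A x\<close> is the
  average of \<open>Q\<close> ahead of \<open>x\<close>, can be solved for the outer occurrence of \<open>Q\<close>, so that a profile is a
  fixed point of \<open>T Q x = fbar / (kappa x * v (A x))\<close>. Since \<open>v\<close> decreases, a larger \<open>Q\<close> gives a larger
  \<open>T Q\<close>; since \<open>kappa\<close> drops at the interface, \<open>T\<close> maps increasing functions to increasing ones. As
  \<open>rm\<close> and \<open>rp\<close> are a lower and an upper barrier, the Knaster-Tarski argument
  (\<open>order_preserving_fixed_point\<close>) produces increasing fixed points between any ordered pair of
  barriers.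

  The equation on \<open>x > 0\<close> linearized at \<open>rp\<close> has the solutions \<open>a * exp (- mu * x)\<close> where the Laplace
  transform of the kernel at \<open>mu\<close> equals \<open>v rp / (- rp * v1 rp)\<close>. This number is positive,
  and it is below 1 precisely because \<open>rp\<close> is beyond the maximum of the flux; so a rate \<open>mu > 0\<close> exists.
  Put \<open>y = a * exp (- mu * x)\<close>. By concavity of \<open>v\<close>, the function \<open>rp - y\<close> is a lower barrier on the right
  (\<open>exponential_subsolution\<close>); for large \<open>B\<close>, the function \<open>rp - y + B * y^2\<close> is an upper barrier
  wherever it lies below \<open>rp\<close> (\<open>corrected_exponential_supersolution\<close>), because the correction decays
  at the rate \<open>2 * mu\<close>, where the linearized operator has a definite sign. The fixed point between
  the two barriers satisfies \<open>rp - Q x \<sim> a * exp (- mu * x)\<close>, so the amplitude \<open>a > 0\<close> can be read off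
  from \<open>Q\<close>, and different amplitudes give different profiles.

  Such a fixed point increases and thus has a limit \<open>l\<close> at minus infinity, with \<open>rm \<le> l \<le> rp\<close>. Its
  average has the same limit, so \<open>l\<close> carries the flux \<open>fbar\<close> on the left. On the left the
  flux exceeds \<open>fbar\<close> on all of \<open>]rm, rp]\<close>, and hence \<open>l = rm\<close> (\<open>fixed_point_left_limit\<close>).

  Finally, the average of any bounded measurable function is continuous (\<open>ahead_continuous\<close>). The
  equation then exhibits every profile as \<open>fbar / (kappa x * c x)\<close> with a continuous positive \<open>c\<close>:
  it is continuous off the interface, and its traces there differ by the factor \<open>km / kp\<close>.
\<close>

section \<open>Calculus and order preliminaries\<close>

lemma derivative_mean_value:
  fixes F F' :: "real \<Rightarrow> real"
  assumes "\<And>r. r \<in> {0..1} \<Longrightarrow> (F has_real_derivative F' r) (at r within {0..1})"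
    and "0 \<le> a" "a < b" "b \<le> 1"
  obtains \<xi> where "a < \<xi>" "\<xi> < b" "F b - F a = F' \<xi> * (b - a)"
proof -
  have "\<exists>x\<in>{a<..<b}. F b - F a = (\<lambda>t. F' x * t) (b - a)"
  proof (rule mvt_simple)
    fix x assume x: "a \<le> x" "x \<le> b"
    have "(F has_real_derivative F' x) (at x within {a..b})"
      using assms(1)[of x] x assms(2-4)
      by (intro has_field_derivative_subset[where s = "{0..1}" and t = "{a..b}"]) auto
    then show "(F has_derivative (\<lambda>t. F' x * t)) (at x within {a..b})"
      by (simp add: has_field_derivative_def)
  qed (use assms in auto)
  then show ?thesis using that by auto
qed

text \<open>
  The value at 0 is arbitrary, so the function is split into its restrictions to the point and to
  its complement.
\<close>

lemma monotone_on_punctured_borel: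
  fixes Q :: "real \<Rightarrow> real"
  assumes "monotone_on (UNIV - {0}) (\<le>) (\<le>) Q"
  shows "Q \<in> borel_measurable borel"
proof -
  have r: "Q \<in> borel_measurable (restrict_space borel A)" if "0 \<notin> A" for A
    by (rule borel_measurable_mono_on_fnc)
       (use assms that in \<open>auto simp: monotone_on_def\<close>)
  show ?thesis
  proof (rule measurable_piecewise_restrict[where C = "{{0}, -{0}}"])
    fix A :: "real set" assume "A \<in> {{0}, - {0}}"
    then consider "A = {0}" | "A = -{0}" by auto
    then show "Q \<in> borel_measurable (restrict_space borel A)"
    proof cases
      case 1
      then show ?thesis by (intro borel_measurable_mono_on_fnc) (auto simp: monotone_on_def)
    qed (auto intro: r)
  qed auto
qed

text \<open>
  The Knaster-Tarski argument: the supremum of all members of \<open>C\<close> with \<open>Q \<le> T Q\<close> is a fixed point.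
  Stating it for a class closed under pointwise suprema covers classes that are cut out by an upper
  barrier which is not itself a member.
\<close>

lemma order_preserving_fixed_point:
  fixes T :: "('a \<Rightarrow> real) \<Rightarrow> 'a \<Rightarrow> real"
  assumes bounded: "\<And>x. bdd_above ((\<lambda>Q. Q x) ` C)"
    and sup_closed: "\<And>S. S \<noteq> {} \<Longrightarrow> S \<subseteq> C \<Longrightarrow> (\<lambda>x. SUP Q\<in>S. Q x) \<in> C"
    and invariant: "\<And>Q. Q \<in> C \<Longrightarrow> T Q \<in> C"
    and preserving: "\<And>Q R. Q \<in> C \<Longrightarrow> R \<in> C \<Longrightarrow> Q \<le> R \<Longrightarrow> T Q \<le> T R"
    and lo: "lo \<in> C" "lo \<le> T lo"
  obtains Q where "Q \<in> C" "lo \<le> Q" "T Q = Q"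
proof -
  define S where "S = {Q \<in> C. Q \<le> T Q}"
  define U where "U = (\<lambda>x. SUP Q\<in>S. Q x)"
  have SC: "S \<subseteq> C" by (auto simp: S_def)
  have loS: "lo \<in> S" using lo by (simp add: S_def)
  have UC: "U \<in> C" unfolding U_def using loS SC by (intro sup_closed) auto
  have upper: "Q \<le> U" if "Q \<in> S" for Q
    unfolding U_def le_fun_def using that
    by (intro allI cSUP_upper bdd_above_mono[OF bounded image_mono[OF SC]])
  have least: "U \<le> R" if "\<And>Q. Q \<in> S \<Longrightarrow> Q \<le> R" for R
    unfolding U_def le_fun_def using that loS
    by (intro allI cSUP_least) (auto simp: le_fun_def)
  have sub: "U \<le> T U"
  proof (rule least)
    fix Q assume Q: "Q \<in> S"
    then have "Q \<le> T Q" by (simp add: S_def)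
    also have "T Q \<le> T U" using Q SC UC upper by (intro preserving) auto
    finally show "Q \<le> T U" .
  qed
  have "T U \<in> S" unfolding S_def using sub UC by (auto intro: invariant preserving)
  then have "T U \<le> U" by (rule upper)
  then show ?thesis using that[of U] UC sub upper[OF loS] by simp
qed

lemma derivative_integral_zero:
  fixes p p' :: "real \<Rightarrow> real"
  assumes p: "\<And>x. (p has_real_derivative p' x) (at x)"
    and supp: "\<And>x. \<bar>x\<bar> > R \<Longrightarrow> p x = 0"
  shows "(p' has_integral 0) UNIV"
proof -
  define b where "b = \<bar>R\<bar> + 1"
  have "(p' has_integral (p b - p (- b))) {- b..b}"
    by (rule fundamental_theorem_of_calculus)
       (use p in \<open>auto simp: b_def has_real_derivative_iff_has_vector_derivative[symmetric]
          intro: has_field_derivative_at_within\<close>)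
  moreover have "p b = 0" "p (- b) = 0" by (auto simp: b_def intro!: supp)
  ultimately have "(p' has_integral 0) {- b..b}" by simp
  then show ?thesis
  proof (rule has_integral_on_superset)
    fix x assume "x \<notin> {- b..b}"
    then have x: "x \<in> - {- \<bar>R\<bar>..\<bar>R\<bar>}" by (auto simp: b_def)
    have "(p has_real_derivative 0) (at x)"
      by (rule has_field_derivative_transform_within_open[of "\<lambda>_. 0" 0 x "- {- \<bar>R\<bar>..\<bar>R\<bar>}"])
         (use x supp in auto)
    then show "p' x = 0" using p DERIV_unique by blast
  qed simp
qed

text \<open>
  The flux equals a constant off a single point, and the derivative of a compactly supported
  function has integral 0.
\<close>

lemma stationary_solution_of_constant_flux:
  assumes "\<And>x. x \<noteq> 0 \<Longrightarrow> Q x * kappa km kp x * v (avg h w Q x) = fbar"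
  shows "stationary_solution km kp h v w Q"
  unfolding stationary_solution_def
proof (intro allI impI, elim conjE exE)
  fix p p' :: "real \<Rightarrow> real" and R
  assume "\<forall>x. (p has_real_derivative p' x) (at x)" "\<forall>x. \<bar>x\<bar> > R \<longrightarrow> p x = 0"
  then have "(p' has_integral 0) UNIV" by (intro derivative_integral_zero[of p p' R]) auto
  then have "((\<lambda>x. fbar * p' x) has_integral fbar * 0) UNIV"
    by (rule has_integral_mult_right)
  then have "((\<lambda>x. fbar * p' x) has_integral 0) UNIV" by simp
  then show "((\<lambda>x. Q x * kappa km kp x * v (avg h w Q x) * p' x) has_integral 0) UNIV"
    by (rule has_integral_spike_finite[of "{0}", rotated 2]) (use assms in auto)
qed

lemma avg_cong_off_0:
  assumes "\<And>y. y \<noteq> 0 \<Longrightarrow> Q y = R y"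
  shows "avg h w Q x = avg h w R x"
  unfolding avg_def by (rule integral_spike[of "{0}"]) (use assms in auto)

section \<open>Averages against a one-sided kernel\<close>

locale lookahead_kernel =
  fixes h :: real and w :: "real \<Rightarrow> real"
  assumes h_pos: "h > 0"
    and w_nonneg: "\<And>x. x \<ge> 0 \<Longrightarrow> w x \<ge> 0"
    and w_continuous: "continuous_on {0<..} w"
    and w_bounded: "bounded (w ` {0<..})"
    and w_mass: "(w has_integral 1) {0..h}"
    and w_support: "\<And>x. x \<ge> h \<Longrightarrow> w x = 0"
begin

text \<open>
  The kernel extended by 0 to the whole line, so that averages become Lebesgue integrals over the
  line. The value \<open>w 0\<close>, which may break continuity and boundedness, is dropped.
\<close>

definition W :: "real \<Rightarrow> real" where
  "W s = (if 0 < s then w s else 0)"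

definition ahead :: "(real \<Rightarrow> real) \<Rightarrow> real \<Rightarrow> real" where
  "ahead Q x = (\<integral>s. Q (x + s) * W s \<partial>lborel)"

lemma W_nonneg: "W s \<ge> 0"
  by (simp add: W_def w_nonneg)

lemma W_nonzeroD:
  assumes "W s \<noteq> 0"
  shows "0 < s" "s < h"
proof -
  show "0 < s" using assms by (simp add: W_def split: if_splits)
  show "s < h" using assms w_support[of s] by (cases "s < h") (simp_all add: W_def split: if_splits)
qed

lemma W_borel [measurable]: "W \<in> borel_measurable borel"
proof -
  have "(\<lambda>s. indicat_real {0<..} s *\<^sub>R w s) \<in> borel_measurable borel"
    by (rule borel_measurable_continuous_on_indicator) (simp_all add: w_continuous)
  moreover have "W = (\<lambda>s. indicat_real {0<..} s *\<^sub>R w s)"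
    by (auto simp: W_def)
  ultimately show ?thesis by simp
qed

lemma W_bounded: obtains K where "K > 0" "\<And>s. W s \<le> K"
proof -
  obtain K where K: "K > 0" "\<And>s. s > 0 \<Longrightarrow> \<bar>w s\<bar> \<le> K"
    using w_bounded by (auto simp: bounded_pos)
  have "W s \<le> K" for s
    using K(1) K(2)[of s] by (auto simp: W_def)
  then show ?thesis using K(1) that by blast
qed

lemma weighted_integrable:
  assumes [measurable]: "g \<in> borel_measurable borel"
    and bound: "\<And>s. 0 < s \<Longrightarrow> s < h \<Longrightarrow> \<bar>g s\<bar> \<le> C"
  shows "integrable lborel (\<lambda>s. g s * W s)"
proof -
  obtain K where K: "K > 0" "\<And>s. W s \<le> K" by (rule W_bounded) blast
  show ?thesis
  proof (rule Bochner_Integration.integrable_bound)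
    show "integrable lborel (\<lambda>s. (C * K) * indicator {0..h} s :: real)"
      by (intro integrable_mult_right integrable_real_indicator) (auto simp: emeasure_lborel_Icc_eq)
    have "norm (g s * W s) \<le> norm (C * K * indicator {0..h} s)" for s
    proof (cases "W s = 0")
      case False
      then have s: "0 < s" "s < h" by (auto dest: W_nonzeroD)
      have "\<bar>g s\<bar> * W s \<le> C * K"
        using bound[OF s] K(2)[of s] W_nonneg[of s] by (intro mult_mono) auto
      moreover have "0 \<le> C * K" using bound[OF s] K(1) by simp
      ultimately have "\<bar>g s\<bar> * W s \<le> \<bar>C * K\<bar>" by linarith
      then show ?thesis using s W_nonneg[of s] by (simp add: abs_mult)
    qed auto
    then show "AE s in lborel. norm (g s * W s) \<le> norm (C * K * indicator {0..h} s)" by simp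
  qed measurable
qed

lemma integrable_W: "integrable lborel W"
  using weighted_integrable[of "\<lambda>_. 1" 1] by simp

lemma integral_W: "(\<integral>s. W s \<partial>lborel) = 1"
proof -
  have "(W has_integral 1) {0..h}"
    by (rule has_integral_spike_finite[OF _ _ w_mass, of "{0}"]) (auto simp: W_def)
  then have "(W has_integral 1) UNIV"
  proof (rule has_integral_on_superset)
    show "W s = 0" if "s \<notin> {0..h}" for s
      using that W_nonzeroD[of s] by (cases "W s = 0") auto
  qed simp
  moreover have "(W has_integral (\<integral>s. W s \<partial>lborel)) UNIV"
    by (rule has_integral_integral_lborel[OF integrable_W])
  ultimately show ?thesis by (rule has_integral_unique[rotated])
qed

lemma weighted_mono:
  assumes "integrable lborel (\<lambda>s. g s * W s)" "integrable lborel (\<lambda>s. g' s * W s)"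
    and le: "\<And>s. 0 < s \<Longrightarrow> s < h \<Longrightarrow> g s \<le> g' s"
  shows "(\<integral>s. g s * W s \<partial>lborel) \<le> (\<integral>s. g' s * W s \<partial>lborel)"
proof (rule integral_mono[OF assms(1,2)])
  fix s show "g s * W s \<le> g' s * W s"
    using le[of s] W_nonzeroD[of s] W_nonneg[of s]
    by (cases "W s = 0") (auto intro: mult_right_mono)
qed

lemma ahead_integrable:
  assumes [measurable]: "Q \<in> borel_measurable borel" and "\<And>y. \<bar>Q y\<bar> \<le> C"
  shows "integrable lborel (\<lambda>s. Q (x + s) * W s)"
  by (rule weighted_integrable[of _ C]) (use assms(2) in auto)

lemma ahead_lower:
  assumes "integrable lborel (\<lambda>s. Q (x + s) * W s)"
    and "\<And>s. 0 < s \<Longrightarrow> s < h \<Longrightarrow> c \<le> Q (x + s)"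
  shows "c \<le> ahead Q x"
proof -
  have "(\<integral>s. c * W s \<partial>lborel) \<le> ahead Q x"
    unfolding ahead_def using assms integrable_W by (intro weighted_mono) auto
  then show ?thesis by (simp add: integral_W)
qed

lemma ahead_upper:
  assumes "integrable lborel (\<lambda>s. Q (x + s) * W s)"
    and "\<And>s. 0 < s \<Longrightarrow> s < h \<Longrightarrow> Q (x + s) \<le> c"
  shows "ahead Q x \<le> c"
proof -
  have "ahead Q x \<le> (\<integral>s. c * W s \<partial>lborel)"
    unfolding ahead_def using assms integrable_W by (intro weighted_mono) auto
  then show ?thesis by (simp add: integral_W)
qed

lemma ahead_translate: "ahead Q x = (\<integral>y. Q y * W (y - x) \<partial>lborel)"
  using lborel_integral_real_affine[of 1 "\<lambda>y. Q y * W (y - x)" x] by (simp add: ahead_def)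

lemma avg_eq_ahead:
  assumes Q: "Q \<in> borel_measurable borel" "\<And>y. \<bar>Q y\<bar> \<le> C"
  shows "avg h w Q x = ahead Q x"
proof -
  have "integrable lborel (\<lambda>y. Q y * W (y - x))"
    using ahead_integrable[OF Q, where x = x]
      lborel_integrable_real_affine_iff[of 1 "\<lambda>y. Q y * W (y - x)" x] by simp
  then have "((\<lambda>y. Q y * W (y - x)) has_integral ahead Q x) UNIV"
    unfolding ahead_translate by (rule has_integral_integral_lborel)
  moreover have "(\<lambda>y. if y \<in> {x..x + h} then Q y * W (y - x) else 0) = (\<lambda>y. Q y * W (y - x))"
  proof
    show "(if y \<in> {x..x + h} then Q y * W (y - x) else 0) = Q y * W (y - x)" for y
      using W_nonzeroD[of "y - x"] by (cases "W (y - x) = 0") auto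
  qed
  ultimately have "((\<lambda>y. if y \<in> {x..x + h} then Q y * W (y - x) else 0) has_integral ahead Q x) UNIV"
    by simp
  then have "((\<lambda>y. Q y * W (y - x)) has_integral ahead Q x) {x..x + h}"
    by (simp only: has_integral_restrict_UNIV)
  then have "((\<lambda>y. Q y * w (y - x)) has_integral ahead Q x) {x..x + h}"
    by (rule has_integral_spike_finite[of "{x}", rotated 2]) (auto simp: W_def)
  then show ?thesis unfolding avg_def by (rule integral_unique)
qed

lemma W_continuous_off_0:
  assumes "s \<noteq> 0" shows "isCont W s"
proof (cases "0 < s")
  case True
  have "isCont w s"
    using w_continuous True by (simp add: continuous_on_eq_continuous_at)
  moreover have "\<forall>\<^sub>F t in nhds s. w t = W t"
    using eventually_nhds_in_open[of "{0<..}" s] True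
    by (auto simp: W_def elim: eventually_mono)
  ultimately show ?thesis using isCont_cong by blast
next
  case False
  then have "s < 0" using assms by simp
  then have "\<forall>\<^sub>F t in nhds s. W t = (\<lambda>_. 0) t"
    using eventually_nhds_in_open[of "{..<0}" s]
    by (auto simp: W_def elim: eventually_mono)
  then show ?thesis using isCont_cong by fastforce
qed

text \<open>
  In the translated form of the average only the kernel depends on the point, and the kernel is
  continuous except at 0. Hence dominated convergence applies to every bounded measurable \<open>Q\<close>,
  however irregular.
\<close>

lemma ahead_continuous:
  assumes [measurable]: "Q \<in> borel_measurable borel" and C: "\<And>y. \<bar>Q y\<bar> \<le> C"
  shows "isCont (ahead Q) x"
proof -
  obtain K where K: "K > 0" "\<And>s. W s \<le> K" by (rule W_bounded) blast
  have C0: "0 \<le> C" using C[of 0] by linarith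
  have "((\<lambda>z. \<integral>y. Q y * W (y - z) \<partial>lborel) \<longlongrightarrow> (\<integral>y. Q y * W (y - x) \<partial>lborel)) (at x)"
    unfolding tendsto_at_iff_sequentially comp_def
  proof (intro allI impI)
    fix X :: "nat \<Rightarrow> real"
    assume "\<forall>i. X i \<in> UNIV - {x}" and X: "X \<longlonglongrightarrow> x"
    have X1: "\<forall>\<^sub>F i in sequentially. \<bar>X i - x\<bar> < 1"
      using X tendstoD[of X x sequentially 1] by (simp add: dist_real_def)
    \<comment> \<open>From index \<open>N\<close> on, all kernels are supported in one bounded interval,
      which gives the dominating function.\<close>
    then obtain N where N: "\<And>i. i \<ge> N \<Longrightarrow> \<bar>X i - x\<bar> < 1"
      unfolding eventually_sequentially by blast
    have "(\<lambda>i. \<integral>y. Q y * W (y - X (i + N)) \<partial>lborel) \<longlonglongrightarrow> (\<integral>y. Q y * W (y - x) \<partial>lborel)"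
    proof (rule integral_dominated_convergence)
      show "integrable lborel (\<lambda>y. (C * K) * indicator {x - 1..x + 1 + h} y :: real)"
        by (intro integrable_mult_right integrable_real_indicator) (auto simp: emeasure_lborel_Icc_eq)
      have "(\<lambda>i. Q y * W (y - X (i + N))) \<longlonglongrightarrow> Q y * W (y - x)" if "y \<noteq> x" for y
      proof -
        have "(\<lambda>i. y - X (i + N)) \<longlonglongrightarrow> y - x"
          by (intro tendsto_intros LIMSEQ_ignore_initial_segment X)
        then show ?thesis
          using W_continuous_off_0[of "y - x"] that
          by (intro tendsto_mult[OF tendsto_const] isCont_tendsto_compose[of "y - x" W]) auto
      qed
      then show "AE y in lborel. (\<lambda>i. Q y * W (y - X (i + N))) \<longlonglongrightarrow> Q y * W (y - x)"
        using AE_lborel_singleton[of x] by (auto elim: eventually_mono)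
      fix i
      have "norm (Q y * W (y - X (i + N))) \<le> C * K * indicator {x - 1..x + 1 + h} y" for y
      proof (cases "W (y - X (i + N)) = 0")
        case False
        then have "0 < y - X (i + N)" "y - X (i + N) < h" by (auto dest: W_nonzeroD)
        then have "y \<in> {x - 1..x + 1 + h}" using N[of "i + N"] by (auto simp: abs_less_iff)
        moreover have "\<bar>Q y\<bar> * W (y - X (i + N)) \<le> C * K"
          using C[of y] K(2) W_nonneg C0 by (intro mult_mono) auto
        ultimately show ?thesis using W_nonneg by (simp add: abs_mult)
      qed (use C0 K in auto)
      then show "AE y in lborel. norm (Q y * W (y - X (i + N))) \<le> C * K * indicator {x - 1..x + 1 + h} y"
        by simp
    qed measurable
    then show "(\<lambda>i. \<integral>y. Q y * W (y - X i) \<partial>lborel) \<longlonglongrightarrow> (\<integral>y. Q y * W (y - x) \<partial>lborel)"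
      by (rule LIMSEQ_offset)
  qed
  then show ?thesis by (simp add: isCont_def ahead_translate[abs_def])
qed

text \<open>
  Averaging ahead multiplies \<open>exp (- l * x)\<close> by this number, the Laplace transform of the kernel, which
  therefore governs the exponential solutions of the linearized profile equation.
\<close>

definition laplace :: "real \<Rightarrow> real" where
  "laplace l = (\<integral>s. exp (- l * s) * W s \<partial>lborel)"

lemma laplace_integrable:
  assumes "l \<ge> 0"
  shows "integrable lborel (\<lambda>s. exp (- l * s) * W s)"
  by (rule weighted_integrable[of _ 1]) (use assms in auto)

lemma laplace_nonneg: "0 \<le> laplace l"
  unfolding laplace_def by (intro Bochner_Integration.integral_nonneg mult_nonneg_nonneg W_nonneg) simp

lemma laplace_0: "laplace 0 = 1"
  by (simp add: laplace_def integral_W)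

lemma laplace_continuous: "continuous_on {0..} laplace"
proof (rule continuous_on_sequentiallyI)
  fix u :: "nat \<Rightarrow> real" and l
  assume u: "\<forall>n. u n \<in> {0..}" "u \<longlonglongrightarrow> l"
  show "(\<lambda>n. laplace (u n)) \<longlonglongrightarrow> laplace l"
    unfolding laplace_def
  proof (rule integral_dominated_convergence[where w = W])
    show "AE s in lborel. (\<lambda>n. exp (- u n * s) * W s) \<longlonglongrightarrow> exp (- l * s) * W s"
      by (intro AE_I2 tendsto_intros u)
    fix n
    have "norm (exp (- u n * s) * W s) \<le> W s" for s
      using u(1) W_nonneg[of s] W_nonzeroD[of s]
      by (cases "W s = 0") (auto simp: abs_mult intro!: mult_left_le_one_le)
    then show "AE s in lborel. norm (exp (- u n * s) * W s) \<le> W s" by simp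
  qed (use integrable_W in auto)
qed

lemma laplace_at_top: "(laplace \<longlongrightarrow> 0) at_top"
proof -
  have "((\<lambda>l. \<integral>s. exp (- l * s) * W s \<partial>lborel) \<longlongrightarrow> (\<integral>s. 0 \<partial>(lborel :: real measure))) at_top"
  proof (rule integral_dominated_convergence_at_top[where w = W])
    have "((\<lambda>l. exp (- l * s) * W s) \<longlongrightarrow> 0) at_top" for s
    proof (cases "W s = 0")
      case False
      then have "s > 0" by (rule W_nonzeroD)
      then have "filterlim (\<lambda>l. s * l) at_top at_top"
        by (intro filterlim_tendsto_pos_mult_at_top[OF tendsto_const]) (auto simp: filterlim_ident)
      then have "filterlim (\<lambda>l. - l * s) at_bot at_top"
        by (simp add: filterlim_uminus_at_bot mult.commute)
      then have "((\<lambda>l. exp (- l * s)) \<longlongrightarrow> 0) at_top"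
        by (rule filterlim_compose[OF exp_at_bot])
      then show ?thesis by (rule tendsto_mult_left_zero)
    qed auto
    then show "AE s in lborel. ((\<lambda>l. exp (- l * s) * W s) \<longlongrightarrow> 0) at_top" by simp
    have "norm (exp (- l * s) * W s) \<le> W s" if "l \<ge> 0" for s l
      using that W_nonneg[of s] W_nonzeroD[of s]
      by (cases "W s = 0") (auto simp: abs_mult intro!: mult_left_le_one_le)
    then show "\<forall>\<^sub>F l in at_top. AE s in lborel. norm (exp (- l * s) * W s) \<le> W s"
      by (intro eventually_mono[OF eventually_ge_at_top[of 0]] AE_I2)
  qed (use integrable_W in auto)
  then show ?thesis by (simp add: laplace_def[abs_def])
qed

lemma laplace_attains:
  assumes "0 < \<theta>" "\<theta> < 1"
  obtains l where "l > 0" "laplace l = \<theta>"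
proof -
  have "\<forall>\<^sub>F l in at_top. laplace l < \<theta> \<and> l \<ge> 0"
    using order_tendstoD(2)[OF laplace_at_top assms(1)] eventually_ge_at_top[of 0]
    by (rule eventually_conj)
  then obtain b where b: "laplace b < \<theta>" "b \<ge> 0"
    using eventually_happens by fastforce
  have "\<exists>l\<ge>0. l \<le> b \<and> laplace l = \<theta>"
    by (rule IVT2') (use b assms laplace_0 in \<open>auto intro: continuous_on_subset[OF laplace_continuous]\<close>)
  then obtain l where "l \<ge> 0" "laplace l = \<theta>" by blast
  moreover have "l \<noteq> 0" using \<open>laplace l = \<theta>\<close> laplace_0 assms by auto
  ultimately show ?thesis using that[of l] by simp
qed

text \<open>
  Equality would force the kernel to vanish almost everywhere, against its unit mass.
\<close>

lemma laplace_strict_decreasing: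
  assumes "0 \<le> l" "l < m"
  shows "laplace m < laplace l"
proof (rule ccontr)
  let ?d = "\<lambda>s. (exp (- l * s) - exp (- m * s)) * W s"
  have i: "integrable lborel ?d"
    using laplace_integrable[of l] laplace_integrable[of m] assms by (simp add: left_diff_distrib)
  have nn: "0 \<le> ?d s" for s
    using W_nonzeroD[of s] W_nonneg[of s] assms
    by (cases "W s = 0") (auto intro!: mult_nonneg_nonneg mult_right_mono)
  have eq: "(\<integral>s. ?d s \<partial>lborel) = laplace l - laplace m"
    unfolding laplace_def left_diff_distrib
    by (rule Bochner_Integration.integral_diff) (use laplace_integrable assms in auto)
  assume "\<not> ?thesis"
  then have "(\<integral>s. ?d s \<partial>lborel) = 0"
    using eq Bochner_Integration.integral_nonneg[of lborel ?d] nn by simp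
  then have "AE s in lborel. ?d s = 0"
    using integral_nonneg_eq_0_iff_AE[OF i] nn by simp
  moreover have "W s = 0" if "?d s = 0" for s
    using that W_nonzeroD(1)[of s] assms by auto
  ultimately have "AE s in lborel. W s = 0" by (auto elim: eventually_mono)
  then have "(\<integral>s. W s \<partial>lborel) = (\<integral>s. 0 \<partial>(lborel :: real measure))"
    by (intro integral_cong_AE) auto
  then show False by (simp add: integral_W)
qed

end

section \<open>Concave decreasing velocities\<close>

locale concave_velocity =
  fixes v v1 v2 :: "real \<Rightarrow> real"
  assumes v_deriv: "\<And>r. r \<in> {0..1} \<Longrightarrow> (v has_real_derivative v1 r) (at r within {0..1})"
    and v1_deriv: "\<And>r. r \<in> {0..1} \<Longrightarrow> (v1 has_real_derivative v2 r) (at r within {0..1})"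
    and v2_continuous: "continuous_on {0..1} v2"
    and v_1: "v 1 = 0"
    and v1_neg: "\<And>r. r \<in> {0..1} \<Longrightarrow> v1 r < 0"
    and v2_nonpos: "\<And>r. r \<in> {0..1} \<Longrightarrow> v2 r \<le> 0"
begin

lemma v_continuous: "continuous_on {0..1} v"
  using v_deriv DERIV_continuous_on by blast

lemma v_less:
  assumes "0 \<le> a" "a < b" "b \<le> 1" shows "v b < v a"
proof -
  obtain \<xi> where "a < \<xi>" "\<xi> < b" "v b - v a = v1 \<xi> * (b - a)"
    using derivative_mean_value[OF v_deriv assms] by blast
  moreover have "v1 \<xi> * (b - a) < 0"
    using v1_neg[of \<xi>] calculation assms by (intro mult_neg_pos) auto
  ultimately show ?thesis by simp
qed

lemma v_le:
  assumes "0 \<le> a" "a \<le> b" "b \<le> 1" shows "v b \<le> v a"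
  using v_less[of a b] assms by (cases "a = b") auto

lemma v_pos:
  assumes "0 \<le> r" "r < 1" shows "0 < v r"
  using v_less[of r 1] assms v_1 by simp

lemma v_nonneg:
  assumes "0 \<le> r" "r \<le> 1" shows "0 \<le> v r"
  using v_le[of r 1] assms v_1 by simp

text \<open>
  Concavity of \<open>v\<close>, in the form of the mean value theorem applied to \<open>v\<close> and then to \<open>v1\<close>.
\<close>

lemma v_below_tangent:
  assumes "0 \<le> q" "q \<le> r" "r \<le> 1"
  shows "v (r - q) \<le> v r - q * v1 r"
proof (cases "q = 0")
  case False
  then obtain \<xi> where \<xi>: "r - q < \<xi>" "\<xi> < r" "v r - v (r - q) = v1 \<xi> * (r - (r - q))"
    using derivative_mean_value[OF v_deriv, of "r - q" r] assms by auto
  obtain \<eta> where \<eta>: "\<xi> < \<eta>" "\<eta> < r" "v1 r - v1 \<xi> = v2 \<eta> * (r - \<xi>)"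
    using derivative_mean_value[OF v1_deriv, of \<xi> r] \<xi> assms by auto
  have "v2 \<eta> * (r - \<xi>) \<le> 0"
    using v2_nonpos[of \<eta>] \<xi> \<eta> assms by (intro mult_nonpos_nonneg) auto
  then have "v1 r \<le> v1 \<xi>" using \<eta>(3) by simp
  then have "v1 r * q \<le> v1 \<xi> * q" using assms by (intro mult_right_mono) auto
  then show ?thesis using \<xi>(3) by (simp add: mult.commute)
qed simp

text \<open>
  The matching bound from below: the second derivative is bounded on the compact interval, which
  makes \<open>M\<close> uniform in the base point.
\<close>

lemma v_quadratic_lower_bound:
  obtains M where "M \<ge> 0"
    "\<And>r q. 0 \<le> q \<Longrightarrow> q \<le> r \<Longrightarrow> r \<le> 1 \<Longrightarrow> v r - q * v1 r - M * q\<^sup>2 \<le> v (r - q)"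
proof -
  have "bounded (v2 ` {0..1})"
    by (intro compact_imp_bounded compact_continuous_image v2_continuous) simp
  then obtain M where M: "M > 0" "\<And>r. r \<in> {0..1} \<Longrightarrow> \<bar>v2 r\<bar> \<le> M"
    by (auto simp: bounded_pos)
  have "v r - q * v1 r - M * q\<^sup>2 \<le> v (r - q)" if rq: "0 \<le> q" "q \<le> r" "r \<le> 1" for r q
  proof (cases "q = 0")
    case False
    then obtain \<xi> where \<xi>: "r - q < \<xi>" "\<xi> < r" "v r - v (r - q) = v1 \<xi> * (r - (r - q))"
      using derivative_mean_value[OF v_deriv, of "r - q" r] rq by auto
    obtain \<eta> where \<eta>: "\<xi> < \<eta>" "\<eta> < r" "v1 r - v1 \<xi> = v2 \<eta> * (r - \<xi>)"
      using derivative_mean_value[OF v1_deriv, of \<xi> r] \<xi> rq by auto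
    have "- (v2 \<eta> * (r - \<xi>)) = (- v2 \<eta>) * (r - \<xi>)" by simp
    also have "\<dots> \<le> M * q"
      using M(1) M(2)[of \<eta>] \<xi> \<eta> rq by (intro mult_mono) auto
    finally have "v1 \<xi> \<le> v1 r + M * q" using \<eta>(3) by simp
    then have "v1 \<xi> * q \<le> (v1 r + M * q) * q" using rq by (intro mult_right_mono) auto
    then show ?thesis using \<xi>(3) by (simp add: algebra_simps power2_eq_square)
  qed simp
  then show ?thesis using that M(1) by (meson less_imp_le)
qed

end

section \<open>The order-preserving profile operator\<close>

text \<open>
  The last two assumptions express how \<open>rm\<close> and \<open>rp\<close> lie on either side of the maximum of the flux, in
  the form in which the proof needs it: the flux decreases at \<open>rp\<close>, and \<open>rm\<close> is the only state in
  \<open>[rm, rp]\<close> that carries \<open>fbar\<close> on the left.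
\<close>

locale stationary_problem = lookahead_kernel h w + concave_velocity v v1 v2
  for h w v v1 v2 +
  fixes km kp rm rp fbar :: real
  assumes kp_pos: "0 < kp" and drop: "kp < km"
    and rm_pos: "0 < rm" and rm_less_rp: "rm < rp" and rp_less_1: "rp < 1"
    and flux_left: "km * rm * v rm = fbar" and flux_right: "kp * rp * v rp = fbar"
    and supercritical: "v rp + rp * v1 rp < 0"
    and flux_left_above: "\<And>r. rm < r \<Longrightarrow> r \<le> rp \<Longrightarrow> fbar < km * r * v r"
begin

lemma fbar_pos: "0 < fbar"
  unfolding flux_left[symmetric]
  using kp_pos drop rm_pos rm_less_rp rp_less_1 by (intro mult_pos_pos v_pos) auto

lemma kappa_pos: "0 < kappa km kp x"
  using kp_pos drop by (simp add: kappa_def)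

lemma kappa_antimono: "x \<le> y \<Longrightarrow> kappa km kp y \<le> kappa km kp x"
  using drop by (simp add: kappa_def)

definition admissible :: "(real \<Rightarrow> real) set" where
  "admissible = {Q. mono Q \<and> (\<forall>x. rm \<le> Q x \<and> Q x \<le> rp)}"

text \<open>
  The profile equation solved for the outer occurrence of \<open>Q\<close>. At \<open>x = 0\<close> the convention for
  \<open>kappa\<close> makes \<open>T Q\<close> take its right trace, so that \<open>T\<close> preserves monotonicity on the whole line.
\<close>

definition T :: "(real \<Rightarrow> real) \<Rightarrow> real \<Rightarrow> real" where
  "T Q x = fbar / (kappa km kp x * v (ahead Q x))"

lemma admissibleD:
  assumes "Q \<in> admissible"
  shows "x \<le> y \<Longrightarrow> Q x \<le> Q y" "rm \<le> Q x" "Q x \<le> rp" "\<bar>Q x\<bar> \<le> 1"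
    and "Q \<in> borel_measurable borel"
proof -
  show "x \<le> y \<Longrightarrow> Q x \<le> Q y" using assms by (simp add: admissible_def monoD)
  show b: "rm \<le> Q x" "Q x \<le> rp" using assms by (simp_all add: admissible_def)
  show "\<bar>Q x\<bar> \<le> 1" using b rm_pos rp_less_1 by simp
  show "Q \<in> borel_measurable borel"
    using assms by (simp add: admissible_def borel_measurable_mono)
qed

lemma admissible_integrable:
  "Q \<in> admissible \<Longrightarrow> integrable lborel (\<lambda>s. Q (x + s) * W s)"
  by (rule ahead_integrable[OF admissibleD(5,4)])

lemma avg_admissible: "Q \<in> admissible \<Longrightarrow> avg h w Q x = ahead Q x"
  by (rule avg_eq_ahead[OF admissibleD(5,4)])

lemma ahead_admissible_window:
  assumes "Q \<in> admissible"
  shows "Q x \<le> ahead Q x" "ahead Q x \<le> Q (x + h)"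
proof -
  show "Q x \<le> ahead Q x"
    by (rule ahead_lower[OF admissible_integrable[OF assms]]) (simp add: admissibleD(1)[OF assms])
  show "ahead Q x \<le> Q (x + h)"
    by (rule ahead_upper[OF admissible_integrable[OF assms]]) (simp add: admissibleD(1)[OF assms])
qed

lemma ahead_admissible_bounds:
  assumes "Q \<in> admissible"
  shows "rm \<le> ahead Q x" "ahead Q x \<le> rp"
  using ahead_admissible_window[OF assms, of x] admissibleD(2,3)[OF assms]
  by (meson order_trans)+

lemma ahead_mono_point:
  assumes "Q \<in> admissible" "x \<le> y"
  shows "ahead Q x \<le> ahead Q y"
  unfolding ahead_def
  by (intro weighted_mono admissible_integrable admissibleD(1)[OF assms(1)] assms)
     (simp add: assms(2))

lemma ahead_mono_profile:
  assumes "Q \<in> admissible" "R \<in> admissible" "Q \<le> R"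
  shows "ahead Q x \<le> ahead R x"
  unfolding ahead_def using assms
  by (intro weighted_mono admissible_integrable) (auto simp: le_fun_def)

text \<open>
  Both monotonicity properties of \<open>T\<close>, in the point and in the profile, reduce to this comparison.
\<close>

lemma T_comparison:
  assumes "kappa km kp y \<le> kappa km kp x"
    and "rm \<le> ahead Q x" "ahead Q x \<le> ahead R y" "ahead R y \<le> rp"
  shows "T Q x \<le> T R y"
proof -
  have "0 < v (ahead R y)" using assms rm_pos rp_less_1 by (intro v_pos) auto
  moreover have "v (ahead R y) \<le> v (ahead Q x)"
    using assms rm_pos rp_less_1 by (intro v_le) auto
  ultimately show ?thesis unfolding T_def
    using fbar_pos kappa_pos assms(1)
    by (intro divide_left_mono mult_mono mult_pos_pos) (auto simp: less_imp_le)
qed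

text \<open>
  On the left \<open>rm\<close> solves the equation exactly and on the right \<open>rp\<close> does; as \<open>kp < km\<close>, each is still a
  barrier on the other side.
\<close>

lemma T_bounds:
  assumes "rm \<le> ahead Q x" "ahead Q x \<le> rp"
  shows "rm \<le> T Q x" "T Q x \<le> rp"
proof -
  have v: "v rp \<le> v (ahead Q x)" "v (ahead Q x) \<le> v rm" "0 < v rp"
    using assms rm_pos rp_less_1 rm_less_rp by (auto intro!: v_le v_pos)
  have k: "kp \<le> kappa km kp x" "kappa km kp x \<le> km" using drop by (auto simp: kappa_def)
  have p: "0 < kappa km kp x * v (ahead Q x)" using v kappa_pos by (auto intro!: mult_pos_pos)
  have "rm * (kappa km kp x * v (ahead Q x)) \<le> rm * (km * v rm)"
    using v k kp_pos rm_pos by (intro mult_left_mono mult_mono) auto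
  then show "rm \<le> T Q x"
    using p flux_left unfolding T_def by (simp add: pos_le_divide_eq mult_ac)
  have "rp * (kp * v rp) \<le> rp * (kappa km kp x * v (ahead Q x))"
    using v k kp_pos rm_pos rm_less_rp by (intro mult_left_mono mult_mono) auto
  then show "T Q x \<le> rp"
    using p flux_right unfolding T_def by (simp add: pos_divide_le_eq mult_ac)
qed

lemma T_admissible:
  assumes "Q \<in> admissible"
  shows "T Q \<in> admissible"
  unfolding admissible_def
  by (simp add: T_bounds T_comparison ahead_admissible_bounds ahead_mono_point kappa_antimono assms monoI)

lemma T_order_preserving:
  assumes "Q \<in> admissible" "R \<in> admissible" "Q \<le> R"
  shows "T Q \<le> T R"
  unfolding le_fun_def
  by (intro allI T_comparison ahead_admissible_bounds ahead_mono_profile assms order_refl)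

lemma T_fixed_flux:
  assumes "Q \<in> admissible" "T Q = Q"
  shows "Q x * kappa km kp x * v (ahead Q x) = fbar"
proof -
  have "0 < v (ahead Q x)"
    using ahead_admissible_bounds[OF assms(1), of x] rm_pos rp_less_1 by (intro v_pos) auto
  moreover have "Q x = fbar / (kappa km kp x * v (ahead Q x))"
    using assms(2) unfolding T_def[symmetric] by simp
  ultimately show ?thesis using kappa_pos[of x] by simp
qed

text \<open>
  Squeezing the average between \<open>Q x\<close> and \<open>Q (x + h)\<close> shows that it has the same limit \<open>l\<close> as \<open>Q\<close>, so
  the constant state \<open>l\<close> solves the equation on the left; among the states in \<open>[rm, rp]\<close> only \<open>rm\<close> does.
\<close>

lemma fixed_point_left_limit:
  assumes Q: "Q \<in> admissible" and fixed: "T Q = Q"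
  shows "(Q \<longlongrightarrow> rm) at_bot"
proof -
  define l where "l = (INF x. Q x)"
  have bdd: "bdd_below (range Q)" using admissibleD(2)[OF Q] by (auto intro!: bdd_belowI)
  have lim: "(Q \<longlongrightarrow> l) at_bot"
  proof (rule decreasing_tendsto)
    show "\<forall>\<^sub>F x in at_bot. l \<le> Q x" unfolding l_def by (simp add: cINF_lower[OF bdd])
    fix u assume "l < u"
    then obtain y where "Q y < u" unfolding l_def by (auto simp: cINF_less_iff[OF _ bdd])
    then show "\<forall>\<^sub>F x in at_bot. Q x < u"
      using admissibleD(1)[OF Q]
      by (intro eventually_mono[OF eventually_le_at_bot[of y]]) (blast intro: le_less_trans)
  qed
  have l: "rm \<le> l" "l \<le> rp"
    unfolding l_def using admissibleD(2,3)[OF Q]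
    by (auto intro: cINF_greatest cINF_lower2[OF bdd, of 0])
  have ahead_in_unit: "0 \<le> ahead Q x \<and> ahead Q x \<le> 1" for x
    using ahead_admissible_bounds[OF Q, of x] rm_pos rp_less_1 by linarith
  have unit: "0 \<le> l" "l \<le> 1" using l rm_pos rp_less_1 by linarith+
  have "filterlim (\<lambda>x. x + h) at_bot at_bot"
    unfolding filterlim_at_bot
  proof
    show "\<forall>\<^sub>F x in at_bot. x + h \<le> Z" for Z
      by (rule eventually_mono[OF eventually_le_at_bot[of "Z - h"]]) simp
  qed
  then have "((\<lambda>x. Q (x + h)) \<longlongrightarrow> l) at_bot" by (rule filterlim_compose[OF lim])
  then have "(ahead Q \<longlongrightarrow> l) at_bot"
    by (rule tendsto_sandwich[OF always_eventually always_eventually lim, rotated 2])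
       (simp_all only: ahead_admissible_window[OF Q] simp_thms)
  then have "((\<lambda>x. v (ahead Q x)) \<longlongrightarrow> v l) at_bot"
    by (rule continuous_on_tendsto_compose[OF v_continuous])
       (use unit ahead_in_unit in auto)
  then have "((\<lambda>x. Q x * km * v (ahead Q x)) \<longlongrightarrow> l * km * v l) at_bot"
    by (intro tendsto_mult lim tendsto_const)
  moreover have "\<forall>\<^sub>F x in at_bot. Q x * km * v (ahead Q x) = fbar"
  proof (rule eventually_mono[OF eventually_gt_at_bot[of 0]])
    show "Q x * km * v (ahead Q x) = fbar" if "x < 0" for x
      using T_fixed_flux[OF Q fixed, of x] that by (simp add: kappa_def)
  qed
  ultimately have "((\<lambda>x::real. fbar) \<longlongrightarrow> l * km * v l) at_bot"
    by (rule Lim_transform_eventually)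
  then have "l * km * v l = fbar"
    by (simp add: tendsto_const_iff)
  then have "\<not> fbar < km * l * v l" by (simp add: mult_ac)
  then have "\<not> rm < l" using flux_left_above[of l] l by blast
  then have "l = rm" using l by linarith
  then show ?thesis using lim by simp
qed

section \<open>Exponential barriers near the downstream state\<close>

text \<open>
  The choice of the rate cancels the terms linear in \<open>y\<close>. What remains after bounding \<open>v\<close> by its
  tangent at \<open>rp\<close> is the negative quadratic term \<open>laplace \<mu> * y\<^sup>2 * v1 rp\<close>.
\<close>

lemma exponential_subsolution:
  assumes "laplace \<mu> * (- rp * v1 rp) = v rp" "\<mu> \<ge> 0" "0 \<le> y" "y \<le> rp"
  shows "(rp - y) * v (rp - laplace \<mu> * y) \<le> rp * v rp"
proof -
  let ?L = "laplace \<mu>"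
  have L: "0 \<le> ?L" "?L \<le> 1"
    using laplace_nonneg laplace_strict_decreasing[of 0 \<mu>] laplace_0 assms(2)
    by (cases "\<mu> = 0"; simp)+
  have q: "0 \<le> ?L * y" "?L * y \<le> rp"
    using L assms(3,4) mult_left_le_one_le[of y ?L] by auto
  have "(rp - y) * v (rp - ?L * y) \<le> (rp - y) * (v rp - ?L * y * v1 rp)"
    using assms q rp_less_1 by (intro mult_left_mono v_below_tangent) auto
  also have "\<dots> = rp * v rp + y * (?L * (- rp * v1 rp) - v rp) + ?L * y\<^sup>2 * v1 rp"
    by (simp add: algebra_simps power2_eq_square)
  also have "\<dots> = rp * v rp + ?L * y\<^sup>2 * v1 rp" using assms(1) by simp
  also have "\<dots> \<le> rp * v rp"
    using L v1_neg[of rp] rm_pos rm_less_rp rp_less_1 by (simp add: mult_nonneg_nonpos)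
  finally show ?thesis .
qed

text \<open>
  The linear terms in \<open>y\<close> cancel as for the lower barrier. The correction \<open>B * y\<^sup>2\<close> decays at the rate
  \<open>2 * \<mu>\<close>, where the Laplace transform is strictly smaller, and therefore contributes the positive
  amount \<open>g * B * y\<^sup>2\<close> with \<open>g = rp * (- v1 rp) * (laplace \<mu> - laplace (2 * \<mu>))\<close>. The quadratic errors
  are at most \<open>(- v1 rp + M) * y\<^sup>2\<close>, so a large \<open>B\<close> absorbs them. The same \<open>B\<close> serves for every amplitude,
  because \<open>x\<close> and \<open>a\<close> enter only through \<open>y\<close>.
\<close>

lemma corrected_exponential_supersolution:
  assumes L: "laplace \<mu> * (- rp * v1 rp) = v rp" and mu: "0 < \<mu>"
  obtains B where "B > 0" "1 \<le> B * (rp - rm)"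
    "\<And>y. 0 \<le> y \<Longrightarrow> B * y \<le> 1 \<Longrightarrow>
       rp * v rp \<le> (rp - (y - B * y\<^sup>2)) * v (rp - (laplace \<mu> * y - laplace (2 * \<mu>) * B * y\<^sup>2))"
proof -
  let ?L = "laplace \<mu>" and ?L' = "laplace (2 * \<mu>)"
  obtain M where M: "M \<ge> 0"
    "\<And>r q. 0 \<le> q \<Longrightarrow> q \<le> r \<Longrightarrow> r \<le> 1 \<Longrightarrow> v r - q * v1 r - M * q\<^sup>2 \<le> v (r - q)"
    by (rule v_quadratic_lower_bound) blast
  have L_bounds: "0 \<le> ?L'" "?L' < ?L" "?L < 1"
    using laplace_strict_decreasing[of 0 \<mu>] laplace_strict_decreasing[of \<mu> "2 * \<mu>"] laplace_0 mu
    by (auto simp: laplace_nonneg)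
  have r: "0 < rp" "0 < v rp" "v1 rp < 0"
    using rm_pos rm_less_rp rp_less_1 by (auto intro!: v_pos v1_neg)
  define D where "D = - v1 rp"
  define g where "g = rp * D * (?L - ?L')"
  have g: "0 < g" using L_bounds r unfolding g_def D_def by (intro mult_pos_pos) auto
  \<comment> \<open>The first entry keeps \<open>y\<close> below \<open>rp - rm\<close> where the
    barrier is used, the second absorbs the quadratic errors.\<close>
  define B where "B = max (1 / (rp - rm)) ((D + M) / g)"
  have B: "0 < B" "1 \<le> B * (rp - rm)" "D + M \<le> B * g"
    using rm_less_rp g unfolding B_def
    by (auto simp: pos_divide_le_eq[symmetric] less_max_iff_disj)
  have "rp * v rp \<le> (rp - (y - B * y\<^sup>2)) * v (rp - (?L * y - ?L' * B * y\<^sup>2))"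
    if y: "0 \<le> y" "B * y \<le> 1" for y
  proof -
    define p where "p = y - B * y\<^sup>2"
    define q where "q = ?L * y - ?L' * B * y\<^sup>2"
    have By2: "0 \<le> B * y\<^sup>2" "B * y\<^sup>2 \<le> y"
      using B(1) y mult_right_mono[OF y(2,1)] by (auto simp: power2_eq_square mult_ac)
    have y_small: "y \<le> rp"
    proof -
      have "B * y \<le> B * (rp - rm)" using y B by linarith
      then have "y \<le> rp - rm" using B(1) by simp
      then show ?thesis using rm_pos by simp
    qed
    have p: "0 \<le> p" "p \<le> y" using By2 by (auto simp: p_def)
    have "?L' * (B * y\<^sup>2) \<le> ?L * y" using L_bounds By2 by (intro mult_mono) auto
    moreover have "?L * y \<le> y" using L_bounds y mult_left_le_one_le[of y ?L] by auto
    moreover have "0 \<le> ?L' * (B * y\<^sup>2)" using L_bounds By2 by simp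
    ultimately have q: "0 \<le> q" "q \<le> y" by (auto simp: q_def mult.assoc)
    have pq: "p * q \<le> y\<^sup>2" "q\<^sup>2 \<le> y\<^sup>2"
      using p q y by (auto simp: power2_eq_square intro!: mult_mono)
    have linear: "rp * D * q = p * v rp + g * B * y\<^sup>2"
      unfolding L[symmetric] p_def q_def g_def D_def by (simp add: algebra_simps)
    have "(rp - p) * (M * q\<^sup>2) \<le> 1 * (M * y\<^sup>2)"
      using p q pq M(1) rp_less_1 by (intro mult_mono mult_left_mono) auto
    moreover have "D * (p * q) \<le> D * y\<^sup>2"
      using pq r by (intro mult_left_mono) (auto simp: D_def)
    moreover have "(D + M) * y\<^sup>2 \<le> B * g * y\<^sup>2"
      using B(3) by (intro mult_right_mono) auto
    ultimately have "rp * v rp \<le> rp * v rp + (g * B * y\<^sup>2 - D * (p * q) - (rp - p) * (M * q\<^sup>2))"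
      by (simp add: algebra_simps)
    also have "\<dots> = (rp - p) * (v rp - q * v1 rp - M * q\<^sup>2)"
      using linear by (simp add: algebra_simps D_def)
    also have "\<dots> \<le> (rp - p) * v (rp - q)"
      using p q y_small rp_less_1 by (intro mult_left_mono M(2)) auto
    finally show ?thesis by (simp add: p_def q_def)
  qed
  then show ?thesis using that B by blast
qed

lemma weighted_exponential_integral:
  assumes "\<mu> \<ge> 0"
  shows "integrable lborel (\<lambda>s. (c - a * exp (- \<mu> * (x + s)) + b * (exp (- \<mu> * (x + s)))\<^sup>2) * W s)"
    and "(\<integral>s. (c - a * exp (- \<mu> * (x + s)) + b * (exp (- \<mu> * (x + s)))\<^sup>2) * W s \<partial>lborel) =
      c - laplace \<mu> * (a * exp (- \<mu> * x)) + laplace (2 * \<mu>) * (b * (exp (- \<mu> * x))\<^sup>2)"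
proof -
  have split: "(c - a * exp (- \<mu> * (x + s)) + b * (exp (- \<mu> * (x + s)))\<^sup>2) * W s =
      c * W s - a * exp (- \<mu> * x) * (exp (- \<mu> * s) * W s)
        + b * (exp (- \<mu> * x))\<^sup>2 * (exp (- (2 * \<mu>) * s) * W s)" for s
    by (simp add: algebra_simps exp_add[symmetric] power2_eq_square mult_exp_exp)
  note i = integrable_W laplace_integrable[of \<mu>] laplace_integrable[of "2 * \<mu>"]
  show "integrable lborel (\<lambda>s. (c - a * exp (- \<mu> * (x + s)) + b * (exp (- \<mu> * (x + s)))\<^sup>2) * W s)"
    unfolding split using i assms by auto
  show "(\<integral>s. (c - a * exp (- \<mu> * (x + s)) + b * (exp (- \<mu> * (x + s)))\<^sup>2) * W s \<partial>lborel) =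
      c - laplace \<mu> * (a * exp (- \<mu> * x)) + laplace (2 * \<mu>) * (b * (exp (- \<mu> * x))\<^sup>2)"
    unfolding split using i assms by (simp add: integral_W laplace_def)
qed

text \<open>
  The upper barrier is imposed as a constraint on increasing functions, because it need not be
  increasing itself: \<open>rp - y + B * y\<^sup>2\<close> decreases in \<open>x\<close> as long as \<open>2 * B * y > 1\<close>.
\<close>

definition tail_class :: "real \<Rightarrow> real \<Rightarrow> real \<Rightarrow> (real \<Rightarrow> real) set" where
  "tail_class \<mu> B a =
     {Q \<in> admissible. \<forall>x\<ge>0. Q x \<le> rp - a * exp (- \<mu> * x) + B * (a * exp (- \<mu> * x))\<^sup>2}"

lemma tail_class_sup_closed:
  assumes "S \<noteq> {}" "S \<subseteq> tail_class \<mu> B a"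
  shows "(\<lambda>x. SUP Q\<in>S. Q x) \<in> tail_class \<mu> B a"
proof -
  have adm: "Q \<in> admissible" if "Q \<in> S" for Q using assms(2) that by (auto simp: tail_class_def)
  have bdd: "bdd_above ((\<lambda>Q. Q x) ` S)" for x
    by (rule bdd_aboveI2[where M = rp]) (simp add: adm admissibleD)
  obtain R where R: "R \<in> S" using assms(1) by blast
  have "rm \<le> (SUP Q\<in>S. Q x)" for x
    using admissibleD(2)[OF adm[OF R], of x] by (rule order_trans) (rule cSUP_upper[OF R bdd])
  moreover have "(SUP Q\<in>S. Q x) \<le> rp" for x
    by (rule cSUP_least[OF assms(1)]) (simp add: adm admissibleD)
  moreover have "(SUP Q\<in>S. Q x) \<le> (SUP Q\<in>S. Q y)" if "x \<le> y" for x y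
    by (rule cSUP_mono[OF assms(1) bdd]) (use adm admissibleD(1) that in blast)
  moreover have "(SUP Q\<in>S. Q x) \<le> rp - a * exp (- \<mu> * x) + B * (a * exp (- \<mu> * x))\<^sup>2"
    if "x \<ge> 0" for x
    by (rule cSUP_least[OF assms(1)]) (use assms(2) that in \<open>auto simp: tail_class_def\<close>)
  ultimately show ?thesis by (simp add: tail_class_def admissible_def monoI)
qed

text \<open>
  Where \<open>B * y > 1\<close> the constraint exceeds \<open>rp\<close> and holds trivially. Elsewhere the
  constraint, which holds at all points ahead, bounds the average of \<open>Q\<close> by that of the barrier, and
  the supersolution inequality applies.
\<close>

lemma T_tail_class:
  assumes \<mu>: "0 < \<mu>" and a: "0 < a" and B: "B > 0" "1 \<le> B * (rp - rm)"
    and super: "\<And>y. 0 \<le> y \<Longrightarrow> B * y \<le> 1 \<Longrightarrow>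
       rp * v rp \<le> (rp - (y - B * y\<^sup>2)) * v (rp - (laplace \<mu> * y - laplace (2 * \<mu>) * B * y\<^sup>2))"
    and Q: "Q \<in> tail_class \<mu> B a"
  shows "T Q \<in> tail_class \<mu> B a"
proof -
  have adm: "Q \<in> admissible" using Q by (simp add: tail_class_def)
  have "T Q x \<le> rp - a * exp (- \<mu> * x) + B * (a * exp (- \<mu> * x))\<^sup>2" if x: "x \<ge> 0" for x
  proof -
    define y where "y = a * exp (- \<mu> * x)"
    have y: "0 < y" using a by (simp add: y_def)
    have goal: "T Q x \<le> rp - y + B * y\<^sup>2"
    proof (cases "B * y \<le> 1")
      case False
      then have "1 * y \<le> (B * y) * y" using y by (intro mult_right_mono) auto
      then have "rp \<le> rp - y + B * y\<^sup>2" by (simp add: power2_eq_square mult_ac)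
      then show ?thesis
        using T_bounds(2)[OF ahead_admissible_bounds[OF adm], of x] by linarith
    next
      case True
      define q where "q = laplace \<mu> * y - laplace (2 * \<mu>) * B * y\<^sup>2"
      have weight: "ahead Q x \<le> rp - q"
      proof -
        have "ahead Q x \<le> (\<integral>s. (rp - a * exp (- \<mu> * (x + s))
            + (B * a\<^sup>2) * (exp (- \<mu> * (x + s)))\<^sup>2) * W s \<partial>lborel)"
          unfolding ahead_def
        proof (rule weighted_mono[OF admissible_integrable[OF adm]])
          show "Q (x + s) \<le> rp - a * exp (- \<mu> * (x + s)) + (B * a\<^sup>2) * (exp (- \<mu> * (x + s)))\<^sup>2"
            if "0 < s" for s
          proof -
            have "Q (x + s) \<le> rp - a * exp (- \<mu> * (x + s)) + B * (a * exp (- \<mu> * (x + s)))\<^sup>2"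
              using Q that x unfolding tail_class_def by auto
            then show ?thesis by (simp only: power_mult_distrib mult.assoc)
          qed
        qed (rule weighted_exponential_integral(1), use \<mu> in simp)
        also have "\<dots> = rp - q"
          by (subst weighted_exponential_integral(2))
             (use \<mu> in \<open>simp_all add: q_def y_def power_mult_distrib\<close>)
        finally show ?thesis .
      qed
      have low: "rm \<le> ahead Q x" "ahead Q x \<le> rp" using ahead_admissible_bounds[OF adm] by auto
      have "B * y \<le> B * (rp - rm)" using True B by linarith
      then have y_small: "y \<le> rp - rm" using B(1) by simp
      have By2: "0 \<le> B * y\<^sup>2" using B by simp
      have L: "laplace \<mu> \<le> 1" "laplace (2 * \<mu>) \<le> laplace \<mu>" "0 \<le> laplace (2 * \<mu>)"
        using laplace_strict_decreasing[of 0 \<mu>] laplace_strict_decreasing[of \<mu> "2 * \<mu>"] laplace_0 \<mu>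
        by (auto simp: laplace_nonneg)
      have By: "B * y\<^sup>2 \<le> y"
        using mult_right_mono[OF True less_imp_le[OF y]] by (simp add: power2_eq_square mult_ac)
      have "laplace (2 * \<mu>) * (B * y\<^sup>2) \<le> laplace \<mu> * y"
        using L By By2 y by (intro mult_mono) auto
      then have q: "0 \<le> q" by (simp add: q_def mult.assoc)
      have v: "v (rp - q) \<le> v (ahead Q x)"
        using weight low rm_pos rp_less_1 q by (intro v_le) auto
      have "0 < v (ahead Q x)" using low rm_pos rp_less_1 by (intro v_pos) auto
      have "rp * v rp \<le> (rp - (y - B * y\<^sup>2)) * v (rp - q)"
        unfolding q_def using y True by (intro super) auto
      also have "\<dots> \<le> (rp - (y - B * y\<^sup>2)) * v (ahead Q x)"
        using v By2 y_small rm_pos by (intro mult_left_mono) auto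
      finally have "kp * (rp * v rp) \<le> kp * ((rp - (y - B * y\<^sup>2)) * v (ahead Q x))"
        using kp_pos by (intro mult_left_mono) auto
      then have "fbar \<le> (rp - (y - B * y\<^sup>2)) * (kappa km kp x * v (ahead Q x))"
        using flux_right x by (simp add: kappa_def mult_ac)
      then have "T Q x \<le> rp - (y - B * y\<^sup>2)"
        unfolding T_def using kappa_pos[of x] \<open>0 < v (ahead Q x)\<close> by (simp add: pos_divide_le_eq)
      then show ?thesis by simp
    qed
    then show ?thesis by (simp add: y_def)
  qed
  then show ?thesis using T_admissible[OF adm] by (simp add: tail_class_def)
qed

text \<open>
  The lower barrier is the larger of two subsolutions where the exponential one is available, that
  is, on the right of the interface, and the constant one on the left.
\<close>

definition cut_exponential :: "real \<Rightarrow> real \<Rightarrow> real \<Rightarrow> real" where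
  "cut_exponential \<mu> a x = (if x < 0 then rm else max rm (rp - a * exp (- \<mu> * x)))"

lemma cut_exponential_tail_class:
  assumes \<mu>: "0 < \<mu>" and a: "0 < a" and B: "B > 0" "1 \<le> B * (rp - rm)"
  shows "cut_exponential \<mu> a \<in> tail_class \<mu> B a"
proof -
  have "cut_exponential \<mu> a x \<le> cut_exponential \<mu> a y" if "x \<le> y" for x y
  proof -
    have "a * exp (- \<mu> * y) \<le> a * exp (- \<mu> * x)" using \<mu> a that by simp
    then show ?thesis using that by (auto simp: cut_exponential_def)
  qed
  moreover have "rm \<le> cut_exponential \<mu> a x \<and> cut_exponential \<mu> a x \<le> rp" for x
  proof -
    have "0 \<le> a * exp (- \<mu> * x)" using a by simp
    then show ?thesis using rm_less_rp by (auto simp: cut_exponential_def simp del: mult_nonneg_nonneg)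
  qed
  moreover have "cut_exponential \<mu> a x \<le> rp - a * exp (- \<mu> * x) + B * (a * exp (- \<mu> * x))\<^sup>2"
    if "x \<ge> 0" for x
  proof -
    define y where "y = a * exp (- \<mu> * x)"
    have y: "0 < y" using a by (simp add: y_def)
    have "rm \<le> rp - y + B * y\<^sup>2"
    proof (cases "B * y \<le> 1")
      case True
      then have "B * y \<le> B * (rp - rm)" using B by linarith
      then have "y \<le> rp - rm" using B(1) by simp
      moreover have "0 \<le> B * y\<^sup>2" using B by simp
      ultimately show ?thesis by linarith
    next
      case False
      then have "1 * y \<le> (B * y) * y" using y by (intro mult_right_mono) auto
      then show ?thesis using rm_less_rp by (simp add: power2_eq_square mult_ac)
    qed
    moreover have "rp - y \<le> rp - y + B * y\<^sup>2" using B by simp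
    ultimately show ?thesis using that by (simp add: cut_exponential_def y_def)
  qed
  ultimately show ?thesis by (simp add: tail_class_def admissible_def monoI)
qed

lemma cut_exponential_le_T:
  assumes \<mu>: "0 < \<mu>" and a: "0 < a"
    and L: "laplace \<mu> * (- rp * v1 rp) = v rp"
    and adm: "cut_exponential \<mu> a \<in> admissible"
  shows "cut_exponential \<mu> a \<le> T (cut_exponential \<mu> a)"
proof (rule le_funI)
  fix x
  let ?lo = "cut_exponential \<mu> a"
  have bounds: "rm \<le> ahead ?lo x" "ahead ?lo x \<le> rp" using ahead_admissible_bounds[OF adm] by auto
  show "?lo x \<le> T ?lo x"
  proof (cases "x \<ge> 0 \<and> rm < rp - a * exp (- \<mu> * x)")
    case False
    then have "?lo x = rm" by (auto simp: cut_exponential_def)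
    then show ?thesis using T_bounds(1)[OF bounds] by simp
  next
    case True
    define y where "y = a * exp (- \<mu> * x)"
    have y: "0 < y" "y < rp - rm" using a True by (auto simp: y_def)
    have lo: "?lo x = rp - y" using True by (simp add: cut_exponential_def y_def)
    have "rp - laplace \<mu> * y =
        (\<integral>s. (rp - a * exp (- \<mu> * (x + s)) + 0 * (exp (- \<mu> * (x + s)))\<^sup>2) * W s \<partial>lborel)"
      by (subst weighted_exponential_integral(2)) (use \<mu> in \<open>simp_all add: y_def\<close>)
    also have "\<dots> \<le> ahead ?lo x"
      unfolding ahead_def
    proof (rule weighted_mono[OF _ admissible_integrable[OF adm]])
      show "rp - a * exp (- \<mu> * (x + s)) + 0 * (exp (- \<mu> * (x + s)))\<^sup>2 \<le> ?lo (x + s)" if "0 < s" for s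
        using that True by (simp add: cut_exponential_def)
    qed (rule weighted_exponential_integral(1), use \<mu> in simp)
    finally have weight: "rp - laplace \<mu> * y \<le> ahead ?lo x" .
    have L1: "laplace \<mu> \<le> 1"
      using laplace_strict_decreasing[of 0 \<mu>] laplace_0 \<mu> by simp
    have "laplace \<mu> * y \<le> y"
      using L1 y laplace_nonneg[of \<mu>] mult_left_le_one_le[of y "laplace \<mu>"] by simp
    then have "0 \<le> rp - laplace \<mu> * y" using y rm_pos by linarith
    then have "v (ahead ?lo x) \<le> v (rp - laplace \<mu> * y)"
      using weight bounds rp_less_1 by (intro v_le) auto
    then have "(rp - y) * v (ahead ?lo x) \<le> (rp - y) * v (rp - laplace \<mu> * y)"
      using y rm_pos by (intro mult_left_mono) auto
    also have "\<dots> \<le> rp * v rp"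
      using y rm_pos \<mu> by (intro exponential_subsolution L) auto
    finally have "kp * ((rp - y) * v (ahead ?lo x)) \<le> kp * (rp * v rp)"
      using kp_pos by (intro mult_left_mono) auto
    then have "(rp - y) * (kappa km kp x * v (ahead ?lo x)) \<le> fbar"
      using flux_right True by (simp add: kappa_def mult_ac)
    moreover have "0 < v (ahead ?lo x)" using bounds rm_pos rp_less_1 by (intro v_pos) auto
    ultimately show ?thesis
      unfolding lo T_def using kappa_pos[of x] by (simp add: pos_le_divide_eq)
  qed
qed

section \<open>A one-parameter family of profiles\<close>

text \<open>
  The number \<open>v rp / (- rp * v1 rp)\<close> is below 1 because the flux decreases at \<open>rp\<close>, so the Laplace
  transform attains it at some rate \<open>\<mu>\<close>. Neither \<open>\<mu>\<close> nor \<open>B\<close> depends on the amplitude \<open>a\<close>; the fixed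
  point is squeezed between the two barriers with amplitude \<open>a\<close>.
\<close>

lemma fixed_points_with_prescribed_tail:
  obtains \<mu> B where "0 < \<mu>"
    "\<And>a. 0 < a \<Longrightarrow> \<exists>Q \<in> admissible. T Q = Q \<and>
       (\<forall>x\<ge>0. rp - a * exp (- \<mu> * x) \<le> Q x \<and>
               Q x \<le> rp - a * exp (- \<mu> * x) + B * (a * exp (- \<mu> * x))\<^sup>2)"
proof -
  have "0 < v rp" "v1 rp < 0"
    using rm_pos rm_less_rp rp_less_1 by (auto intro!: v_pos v1_neg)
  then have pos: "0 < - rp * v1 rp" using rm_pos rm_less_rp by (simp add: mult_pos_neg)
  obtain \<mu> where \<mu>: "0 < \<mu>" "laplace \<mu> = v rp / (- rp * v1 rp)"
  proof (rule laplace_attains)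
    show "0 < v rp / (- rp * v1 rp)" using \<open>0 < v rp\<close> pos by (rule divide_pos_pos)
    show "v rp / (- rp * v1 rp) < 1" using supercritical pos by (subst pos_divide_less_eq) auto
  qed blast
  have L: "laplace \<mu> * (- rp * v1 rp) = v rp" unfolding \<mu>(2) using pos by (metis nonzero_eq_divide_eq less_irrefl)
  obtain B where B: "B > 0" "1 \<le> B * (rp - rm)"
    "\<And>y. 0 \<le> y \<Longrightarrow> B * y \<le> 1 \<Longrightarrow>
       rp * v rp \<le> (rp - (y - B * y\<^sup>2)) * v (rp - (laplace \<mu> * y - laplace (2 * \<mu>) * B * y\<^sup>2))"
    by (rule corrected_exponential_supersolution[OF L \<mu>(1)]) blast
  have "\<exists>Q \<in> admissible. T Q = Q \<and>
       (\<forall>x\<ge>0. rp - a * exp (- \<mu> * x) \<le> Q x \<and>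
               Q x \<le> rp - a * exp (- \<mu> * x) + B * (a * exp (- \<mu> * x))\<^sup>2)" if a: "0 < a" for a
  proof -
    have sub: "tail_class \<mu> B a \<subseteq> admissible" by (auto simp: tail_class_def)
    have lo: "cut_exponential \<mu> a \<in> tail_class \<mu> B a"
      by (rule cut_exponential_tail_class[OF \<mu>(1) a B(1,2)])
    obtain Q where Q: "Q \<in> tail_class \<mu> B a" "cut_exponential \<mu> a \<le> Q" "T Q = Q"
    proof (rule order_preserving_fixed_point[where C = "tail_class \<mu> B a" and T = T])
      show "bdd_above ((\<lambda>Q. Q x) ` tail_class \<mu> B a)" for x
        by (rule bdd_aboveI2[where M = rp]) (use sub admissibleD(3) in blast)
      show "cut_exponential \<mu> a \<le> T (cut_exponential \<mu> a)"
        by (rule cut_exponential_le_T[OF \<mu>(1) a L]) (use lo sub in blast)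
      show "T R \<in> tail_class \<mu> B a" if "R \<in> tail_class \<mu> B a" for R
        by (rule T_tail_class[OF \<mu>(1) a B that])
    qed (use lo tail_class_sup_closed T_order_preserving sub in blast)+
    have "rp - a * exp (- \<mu> * x) \<le> Q x" if "x \<ge> 0" for x
      using le_funD[OF Q(2), of x] that by (simp add: cut_exponential_def)
    then show ?thesis using Q sub by (auto simp: tail_class_def)
  qed
  then show ?thesis using that \<mu>(1) by blast
qed

text \<open>
  The two barriers agree to first order in \<open>exp (- \<mu> * x)\<close>, so they determine the leading coefficient.
\<close>

lemma tail_amplitude:
  fixes Q :: "real \<Rightarrow> real"
  assumes "0 < \<mu>"
    and "\<And>x. x > 0 \<Longrightarrow> rp - a * exp (- \<mu> * x) \<le> Q x"
    and "\<And>x. x > 0 \<Longrightarrow> Q x \<le> rp - a * exp (- \<mu> * x) + B * (a * exp (- \<mu> * x))\<^sup>2"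
  shows "((\<lambda>x. (rp - Q x) * exp (\<mu> * x)) \<longlongrightarrow> a) at_top"
    and "(Q \<longlongrightarrow> rp) at_top"
proof -
  have "filterlim (\<lambda>x. \<mu> * x) at_top at_top"
    by (intro filterlim_tendsto_pos_mult_at_top[OF tendsto_const assms(1)] filterlim_ident)
  then have "filterlim (\<lambda>x. - \<mu> * x) at_bot at_top"
    by (simp add: filterlim_uminus_at_bot)
  then have e: "((\<lambda>x. exp (- \<mu> * x)) \<longlongrightarrow> 0) at_top"
    by (rule filterlim_compose[OF exp_at_bot])
  show "(Q \<longlongrightarrow> rp) at_top"
  proof (rule tendsto_sandwich)
    show "\<forall>\<^sub>F x in at_top. rp - a * exp (- \<mu> * x) \<le> Q x"
      by (rule eventually_mono[OF eventually_gt_at_top[of 0]]) (rule assms(2))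
    show "\<forall>\<^sub>F x in at_top. Q x \<le> rp - a * exp (- \<mu> * x) + B * (a * exp (- \<mu> * x))\<^sup>2"
      by (rule eventually_mono[OF eventually_gt_at_top[of 0]]) (rule assms(3))
    show "((\<lambda>x. rp - a * exp (- \<mu> * x)) \<longlongrightarrow> rp) at_top"
      using tendsto_diff[OF tendsto_const[of rp] tendsto_mult_right_zero[OF e, of a]] by simp
    show "((\<lambda>x. rp - a * exp (- \<mu> * x) + B * (a * exp (- \<mu> * x))\<^sup>2) \<longlongrightarrow> rp) at_top"
      using tendsto_add[OF tendsto_diff[OF tendsto_const[of rp] tendsto_mult_right_zero[OF e, of a]]
        tendsto_mult_right_zero[OF tendsto_null_power[OF tendsto_mult_right_zero[OF e, of a], of 2], of B]]
      by simp
  qed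
  have inv: "exp (- \<mu> * x) * exp (\<mu> * x) = 1" for x by (simp add: exp_minus_inverse mult.commute flip: exp_add)
  show "((\<lambda>x. (rp - Q x) * exp (\<mu> * x)) \<longlongrightarrow> a) at_top"
  proof (rule tendsto_sandwich)
    show "\<forall>\<^sub>F x in at_top. a - B * a\<^sup>2 * exp (- \<mu> * x) \<le> (rp - Q x) * exp (\<mu> * x)"
    proof (rule eventually_mono[OF eventually_gt_at_top[of 0]])
      fix x :: real assume "0 < x"
      then have "(a * exp (- \<mu> * x) - B * (a * exp (- \<mu> * x))\<^sup>2) * exp (\<mu> * x) \<le> (rp - Q x) * exp (\<mu> * x)"
        using assms(3)[of x] by (intro mult_right_mono) auto
      moreover have "(a * exp (- \<mu> * x) - B * (a * exp (- \<mu> * x))\<^sup>2) * exp (\<mu> * x) =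
          (a - B * a\<^sup>2 * exp (- \<mu> * x)) * (exp (- \<mu> * x) * exp (\<mu> * x))"
        by (simp add: algebra_simps power2_eq_square)
      ultimately show "a - B * a\<^sup>2 * exp (- \<mu> * x) \<le> (rp - Q x) * exp (\<mu> * x)"
        by (simp only: inv mult_1_right)
    qed
    show "\<forall>\<^sub>F x in at_top. (rp - Q x) * exp (\<mu> * x) \<le> a"
    proof (rule eventually_mono[OF eventually_gt_at_top[of 0]])
      fix x :: real assume "0 < x"
      then have "(rp - Q x) * exp (\<mu> * x) \<le> (a * exp (- \<mu> * x)) * exp (\<mu> * x)"
        using assms(2)[of x] by (intro mult_right_mono) auto
      then show "(rp - Q x) * exp (\<mu> * x) \<le> a"
        by (simp only: inv mult_1_right mult.assoc)
    qed
    show "((\<lambda>x. a - B * a\<^sup>2 * exp (- \<mu> * x)) \<longlongrightarrow> a) at_top"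
      using tendsto_diff[OF tendsto_const[of a] tendsto_mult_right_zero[OF e, of "B * a\<^sup>2"]] by simp
  qed simp
qed

lemma fixed_point_profile:
  assumes Q: "Q \<in> admissible" and fixed: "T Q = Q" and right: "(Q \<longlongrightarrow> rp) at_top"
  shows "restrict Q (UNIV - {0}) \<in> monotone_profiles km kp h v w fbar rm rp"
proof -
  let ?R = "restrict Q (UNIV - {0})"
  have flux: "?R x * kappa km kp x * v (avg h w ?R x) = fbar" if "x \<noteq> 0" for x
    using T_fixed_flux[OF Q fixed, of x] that avg_cong_off_0[of ?R Q h w x] avg_admissible[OF Q]
    by simp
  have "?R \<in> (UNIV - {0}) \<rightarrow>\<^sub>E {0..1}"
    using order_trans[OF less_imp_le[OF rm_pos] admissibleD(2)[OF Q]]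
      order_trans[OF admissibleD(3)[OF Q] less_imp_le[OF rp_less_1]] by auto
  moreover have "monotone_on (UNIV - {0}) (\<le>) (\<le>) ?R"
    using admissibleD(1)[OF Q] by (auto simp: monotone_on_def)
  moreover have "(?R \<longlongrightarrow> rp) at_top"
    by (rule Lim_transform_eventually[OF right])
       (rule eventually_mono[OF eventually_gt_at_top[of 0]], simp)
  moreover have "(?R \<longlongrightarrow> rm) at_bot"
    by (rule Lim_transform_eventually[OF fixed_point_left_limit[OF Q fixed]])
       (rule eventually_mono[OF eventually_gt_at_bot[of 0]], simp)
  ultimately show ?thesis
    using flux stationary_solution_of_constant_flux[of ?R, OF flux]
    by (simp add: monotone_profiles_def)
qed

text \<open>
  Every positive amplitude is the leading tail coefficient of some profile. The map \<open>F\<close> that reads this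
  coefficient off thus sends the set of profiles onto a set containing the positive half-line.
\<close>

lemma infinite_profiles: "infinite (monotone_profiles km kp h v w fbar rm rp)"
proof -
  obtain \<mu> B where \<mu>: "0 < \<mu>" and ex: "\<And>a. 0 < a \<Longrightarrow> \<exists>Q \<in> admissible. T Q = Q \<and>
       (\<forall>x\<ge>0. rp - a * exp (- \<mu> * x) \<le> Q x \<and>
               Q x \<le> rp - a * exp (- \<mu> * x) + B * (a * exp (- \<mu> * x))\<^sup>2)"
    by (rule fixed_points_with_prescribed_tail) blast
  define F where "F = (\<lambda>Q::real\<Rightarrow>real. Lim at_top (\<lambda>x. (rp - Q x) * exp (\<mu> * x)))"
  have "{0<..} \<subseteq> F ` monotone_profiles km kp h v w fbar rm rp"
  proof
    fix a :: real assume "a \<in> {0<..}"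
    then obtain Q where Q: "Q \<in> admissible" "T Q = Q"
      "\<And>x. x \<ge> 0 \<Longrightarrow> rp - a * exp (- \<mu> * x) \<le> Q x"
      "\<And>x. x \<ge> 0 \<Longrightarrow> Q x \<le> rp - a * exp (- \<mu> * x) + B * (a * exp (- \<mu> * x))\<^sup>2"
      using ex[of a] by auto
    let ?R = "restrict Q (UNIV - {0})"
    have "(Q \<longlongrightarrow> rp) at_top"
      by (rule tail_amplitude(2)[OF \<mu>, of a Q B]) (use Q(3,4) in auto)
    then have "?R \<in> monotone_profiles km kp h v w fbar rm rp"
      by (rule fixed_point_profile[OF Q(1,2)])
    moreover have "((\<lambda>x. (rp - ?R x) * exp (\<mu> * x)) \<longlongrightarrow> a) at_top"
      by (rule tail_amplitude(1)[OF \<mu>, of a ?R B]) (use Q(3,4) in auto)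
    then have "F ?R = a" unfolding F_def by (intro tendsto_Lim) auto
    ultimately show "a \<in> F ` monotone_profiles km kp h v w fbar rm rp" by blast
  qed
  moreover have "infinite {0::real<..}" by (rule infinite_Ioi)
  ultimately show ?thesis using finite_surj by blast
qed

section \<open>Regularity and the jump at the interface\<close>

text \<open>
  Monotonicity makes \<open>Q\<close> measurable, so its average is continuous, and dividing the equation by
  \<open>kappa x * v (avg h w Q x)\<close> transfers the continuity to \<open>Q\<close> on each side.
\<close>

lemma profile_regularity:
  assumes Q: "Q \<in> monotone_profiles km kp h v w fbar rm rp"
  shows "\<exists>Qm Qp. (Q \<longlongrightarrow> Qm) (at_left 0) \<and> (Q \<longlongrightarrow> Qp) (at_right 0) \<and> Qm \<noteq> Qp"
    and "continuous_on {..<0} Q" and "continuous_on {0<..} Q"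
proof -
  \<comment> \<open>A profile has an unspecified value at 0; the modified function takes values in
    \<open>[0, 1]\<close> everywhere and has the same averages.\<close>
  define R where "R = Q(0 := 0)"
  have R01: "0 \<le> R x" "R x \<le> 1" for x
    using Q by (auto simp: monotone_profiles_def R_def PiE_iff)
  have mono: "monotone_on (UNIV - {0}) (\<le>) (\<le>) R \<or> monotone_on (UNIV - {0}) (\<le>) (\<ge>) R"
    using Q by (auto simp: monotone_profiles_def R_def monotone_on_def)
  have borel: "R \<in> borel_measurable borel"
    using mono
  proof
    assume "monotone_on (UNIV - {0}) (\<le>) (\<ge>) R"
    then have "(\<lambda>x. - R x) \<in> borel_measurable borel"
      by (intro monotone_on_punctured_borel) (auto simp: monotone_on_def)
    then show ?thesis by simp
  qed (rule monotone_on_punctured_borel)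
  have abs: "\<bar>R x\<bar> \<le> 1" for x using R01[of x] by simp
  define c where "c = (\<lambda>x. v (ahead R x))"
  have unit: "0 \<le> ahead R x" "ahead R x \<le> 1" for x
    using R01 ahead_integrable[OF borel abs] by (auto intro: ahead_lower ahead_upper)
  have cont: "continuous_on UNIV c"
    unfolding c_def
  proof (rule continuous_on_compose2[OF v_continuous])
    show "continuous_on UNIV (ahead R)"
      using ahead_continuous[OF borel abs] by (simp add: continuous_at_imp_continuous_on)
  qed (use unit in auto)
  have "avg h w Q x = ahead R x" for x
  proof -
    have "avg h w Q x = avg h w R x" by (rule avg_cong_off_0) (simp add: R_def)
    also have "\<dots> = ahead R x" by (rule avg_eq_ahead[OF borel abs])
    finally show ?thesis .
  qed
  then have flux: "Q x * kappa km kp x * c x = fbar" if "x \<noteq> 0" for x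
    using Q that by (auto simp: monotone_profiles_def c_def)
  have c_lower: "fbar / km \<le> c x" if "x \<noteq> 0" for x
  proof -
    have "0 \<le> c x" unfolding c_def using unit by (intro v_nonneg)
    moreover have "0 \<le> Q x" "Q x \<le> 1" using R01[of x] that by (auto simp: R_def)
    moreover have "0 \<le> kappa km kp x" "kappa km kp x \<le> km" using kp_pos drop by (auto simp: kappa_def)
    ultimately have "Q x * kappa km kp x * c x \<le> 1 * km * c x"
      by (intro mult_right_mono mult_mono) auto
    then show ?thesis using flux[OF that] kp_pos drop by (simp add: pos_divide_le_eq mult.commute)
  qed
  \<comment> \<open>The equation says nothing at 0, but the bound passes to the limit; so the average
    of \<open>Q\<close> ahead of the interface cannot reach the jam density 1.\<close>
  have lower0: "fbar / km \<le> c 0"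
  proof (rule tendsto_lowerbound)
    show "(c \<longlongrightarrow> c 0) (at 0)" using cont by (simp add: continuous_on_def)
    show "\<forall>\<^sub>F x in at 0. fbar / km \<le> c x"
      by (rule eventually_mono[OF eventually_neq_at_within[of 0]]) (rule c_lower)
  qed simp
  have c_pos: "0 < c x" for x
  proof -
    have "0 < fbar / km" using fbar_pos kp_pos drop by simp
    also have "\<dots> \<le> c x" using c_lower[of x] lower0 by (cases "x = 0") auto
    finally show ?thesis .
  qed
  have left: "Q x = fbar / (km * c x)" if "x < 0" for x
    using flux[of x] that c_pos[of x] kp_pos drop by (simp add: kappa_def field_simps)
  have right: "Q x = fbar / (kp * c x)" if "x > 0" for x
    using flux[of x] that c_pos[of x] kp_pos by (simp add: kappa_def field_simps)
  have branch: "continuous_on UNIV (\<lambda>x. fbar / (k * c x))" if "0 < k" for k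
  proof (intro continuous_intros cont ballI)
    show "k * c x \<noteq> 0" for x using that c_pos[of x] by simp
  qed
  have km: "0 < km" using kp_pos drop by simp
  show "continuous_on {..<0} Q"
    using continuous_on_subset[OF branch[OF km]] left by (subst continuous_on_cong[OF refl]) auto
  show "continuous_on {0<..} Q"
    using continuous_on_subset[OF branch[OF kp_pos]] right by (subst continuous_on_cong[OF refl]) auto
  have lim: "((\<lambda>x. fbar / (k * c x)) \<longlongrightarrow> fbar / (k * c 0)) (at 0 within S)" if "0 < k" for k S
    using branch[OF that] by (auto simp: continuous_on_def intro: tendsto_within_subset)
  have "(Q \<longlongrightarrow> fbar / (km * c 0)) (at_left 0)"
    by (rule Lim_transform_eventually[OF lim[OF km]])
       (auto simp: eventually_at_filter left intro!: always_eventually)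
  moreover have "(Q \<longlongrightarrow> fbar / (kp * c 0)) (at_right 0)"
    by (rule Lim_transform_eventually[OF lim[OF kp_pos]])
       (auto simp: eventually_at_filter right intro!: always_eventually)
  moreover have "fbar / (km * c 0) \<noteq> fbar / (kp * c 0)"
    using fbar_pos c_pos[of 0] kp_pos drop by (simp add: field_simps)
  ultimately show "\<exists>Qm Qp. (Q \<longlongrightarrow> Qm) (at_left 0) \<and> (Q \<longlongrightarrow> Qp) (at_right 0) \<and> Qm \<noteq> Qp"
    by blast
qed

end

section \<open>Profiles across a drop of the road capacity\<close>

theorem theorem2p2:
  fixes h km kp rhat rm rp fbar :: real
    and v v1 v2 w w1 :: "real \<Rightarrow> real"
    and f_rho :: "real \<Rightarrow> real \<Rightarrow> real"
  assumes "h > 0" and "km > 0" and "kp > 0"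
    and "\<And>r. r \<in> {0..1} \<Longrightarrow> (v has_real_derivative v1 r) (at r within {0..1})"
    and "\<And>r. r \<in> {0..1} \<Longrightarrow> (v1 has_real_derivative v2 r) (at r within {0..1})"
    and "continuous_on {0..1} v2"
    and "v 0 = 1" and "v 1 = 0"
    and "\<And>r. r \<in> {0..1} \<Longrightarrow> v1 r < 0"
    and "\<And>r. r \<in> {0..1} \<Longrightarrow> v2 r \<le> 0"
    and "\<And>x. x \<ge> 0 \<Longrightarrow> w x \<ge> 0"
    and "continuous_on {0<..} w"
    and "bounded (w ` {0<..})"
    and "(w has_integral 1) {0..h}"
    and "\<And>x. x \<ge> h \<Longrightarrow> w x = 0"
    and "\<And>x. x \<in> {0<..<h} \<Longrightarrow> (w has_real_derivative w1 x) (at x)"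
    and "\<And>x. x \<in> {0<..<h} \<Longrightarrow> w1 x < 0"
    and "rhat \<in> {0<..<1}"
    and "\<And>k r. k > 0 \<Longrightarrow> r \<in> {0..1} \<Longrightarrow>
           (flux v k has_real_derivative f_rho k r) (at r within {0..1})"
    and "\<And>k. k > 0 \<Longrightarrow> f_rho k rhat = 0"
    and "\<And>k r. k > 0 \<Longrightarrow> r \<in> {0..1} \<Longrightarrow> r < rhat \<Longrightarrow> f_rho k r > 0"
    and "\<And>k r. k > 0 \<Longrightarrow> r \<in> {0..1} \<Longrightarrow> r > rhat \<Longrightarrow> f_rho k r < 0"
    and "km > kp"
    and "0 < rm" and "rm < rhat" and "rhat < rp" and "rp < 1"
    and "flux v km rm = fbar" and "flux v kp rp = fbar"
  shows "infinite (monotone_profiles km kp h v w fbar rm rp) \<and>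
    (\<forall>Q \<in> monotone_profiles km kp h v w fbar rm rp.
       (\<exists>Qm Qp. (Q \<longlongrightarrow> Qm) (at_left 0) \<and> (Q \<longlongrightarrow> Qp) (at_right 0) \<and> Qm \<noteq> Qp) \<and>
       continuous_on {..<0} Q \<and> continuous_on {0<..} Q)"
proof -
  interpret concave_velocity v v1 v2
    by unfold_locales (use assms(4-6,8-10) in auto)
  note flux_mvt = derivative_mean_value[OF assms(19)]
  have up: "flux v km a < flux v km b" if ab: "0 \<le> a" "a < b" "b \<le> rhat" for a b
  proof -
    obtain \<xi> where "a < \<xi>" "\<xi> < b" "flux v km b - flux v km a = f_rho km \<xi> * (b - a)"
      by (rule flux_mvt[of km a b]) (use ab assms(2,18) in auto)
    moreover have "0 < f_rho km \<xi> * (b - a)"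
      using calculation ab assms(2,18) by (intro mult_pos_pos assms(21)) auto
    ultimately show ?thesis by simp
  qed
  have down: "flux v km b < flux v km a" if ab: "rhat \<le> a" "a < b" "b \<le> 1" for a b
  proof -
    obtain \<xi> where "a < \<xi>" "\<xi> < b" "flux v km b - flux v km a = f_rho km \<xi> * (b - a)"
      by (rule flux_mvt[of km a b]) (use ab assms(2,18) in auto)
    moreover have "f_rho km \<xi> * (b - a) < 0"
      using calculation ab assms(2,18) by (intro mult_neg_pos assms(22)) auto
    ultimately show ?thesis by simp
  qed
  have rp: "rp \<in> {0..1}" "0 < rp" using assms(24-27) by auto
  have "0 < v rp" using rp assms(27) by (intro v_pos) auto
  then have at_rp: "fbar < flux v km rp"
    using assms(23,29) rp by (auto simp: flux_def)
  have above: "fbar < km * r * v r" if r: "rm < r" "r \<le> rp" for r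
  proof (cases "r \<le> rhat")
    case True
    then show ?thesis using up[of rm r] r assms(24,28) by (simp add: flux_def)
  next
    case False
    then show ?thesis
      using down[of r rp] r at_rp assms(27) by (cases "r = rp") (auto simp: flux_def)
  qed
  have at_rp_filter: "at rp within {0..1} = at rp"
    using rp assms(27) by (intro at_within_Icc_at) auto
  \<comment> \<open>The sign of \<open>f_rho k rp\<close> gives the decrease of \<open>r * v r\<close>
    at \<open>rp\<close>; the coefficient \<open>k = 1\<close> makes the two coincide.\<close>
  have "(flux v 1 has_real_derivative f_rho 1 rp) (at rp)"
    using assms(19)[of 1 rp] rp by (simp add: at_rp_filter)
  moreover have "(flux v 1 has_real_derivative v rp + rp * v1 rp) (at rp)"
    using assms(4)[OF rp(1)] unfolding flux_def[abs_def] at_rp_filter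
    by (auto intro!: derivative_eq_intros)
  ultimately have "f_rho 1 rp = v rp + rp * v1 rp" by (rule DERIV_unique)
  then have super: "v rp + rp * v1 rp < 0"
    using assms(22)[of 1 rp] rp assms(26) by simp
  interpret stationary_problem h w v v1 v2 km kp rm rp fbar
    by unfold_locales
       (use assms(1,3,11-15,23-29) above super in \<open>auto simp: flux_def\<close>)
  show ?thesis using infinite_profiles profile_regularity by blast
qed

end
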